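(* Let $A$ be an $n\times n$ pseudo principal matrix of $\mathbf{a}=(a_1,\dots,a_n)$, where the $a_i$ are positive integers. Suppose $\operatorname{rank}A=n-1$ and that some principal minor of $A$ of size $n-1$ vanishes. Then, after a possible reordering of $a_1,\dots,a_n$ (with the corresponding simultaneous permutation of the rows and columns of $A$), there is an integer $s$ with $1\le s<n$ such that $$A=\begin{bmatrix} D&\mathbf{0}_{(n-s)\times s}\\ C_{s\times (n-s)}&B_{s\times s}\end{bmatrix},$$ where $D$ is an $(n-s)\times(n-s)$ pseudo principal matrix of rank $n-s-1$. Moreover, if $A$ is a principal matrix of $\mathbf{a}$, then $D$ is a principal matrix of $\{a_1,\dots,a_{n-s}\}$ (in the new ordering).
   Context: An $n\times n$ integer matrix $A=(a_{ij})$ is called pseudo principal if $a_{ii}<0$ for all $i$, $a_{ij}\ge 0$ for all $i\ne j$, and there exist positive integers $a_1,\dots,a_n$ such that $A(a_1,\dots,a_n)^T=0$; one then says $A$ is a pseudo principal matrix of $\mathbf{a}=(a_1,\dots,a_n)$. For a set $\mathbf{a}=\{a_1,\dots,a_n\}$ of positive integers, $\langle \mathbf{a}\rangle$ denotes the additive monoid of all non-negative integer combinations of the $a_i$. If $\mathbf{a}$ minimally generates $\langle\mathbf{a}\rangle$, a principal matrix of $\mathbf{a}$ is an $n\times n$ integer matrix with diagonal entries $-c_1,\dots,-c_n$ and non-negative off-diagonal entries $a_{ij}$ such that $A(a_1,\dots,a_n)^T=0$ and, for each $i$, $c_i$ is the smallest positive integer with $c_ia_i\in\langle \mathbf{a}\setminus\{a_i\}\rangle$.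 A principal minor is the determinant of a submatrix formed by the rows and columns with indices in the same set; its size is the number of these indices. *)

theory Defs
  imports "Jordan_Normal_Form.DL_Rank_Submatrix"
begin

definition pseudo_principal_of :: "int mat \<Rightarrow> nat vec \<Rightarrow> bool" where
  "pseudo_principal_of A a \<longleftrightarrow>
     A \<in> carrier_mat (dim_vec a) (dim_vec a) \<and>
     (\<forall>i < dim_vec a. A $$ (i, i) < 0) \<and>
     (\<forall>i < dim_vec a. \<forall>j < dim_vec a. i \<noteq> j \<longrightarrow> 0 \<le> A $$ (i, j)) \<and>
     (\<forall>i < dim_vec a. 0 < a $ i) \<and>
     A *\<^sub>v map_vec int a = 0\<^sub>v (dim_vec a)"

definition pseudo_principal :: "int mat \<Rightarrow> bool" where
  "pseudo_principal A \<longleftrightarrow> (\<exists>a. pseudo_principal_of A a)"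

(* Meant for finite S only, where the sum ranges over all non-negative combinations. *)
definition nat_combinations :: "nat set \<Rightarrow> nat set" where
  "nat_combinations S = {\<Sum>x\<in>S. k x * x | k. True}"

(* The entries of a are pairwise distinct, i.e. a enumerates the n-element set
   {a_1, ..., a_n}, and no proper subset of that set generates the same monoid. *)
definition minimally_generates :: "nat vec \<Rightarrow> bool" where
  "minimally_generates a \<longleftrightarrow>
     (\<forall>i < dim_vec a. 0 < a $ i) \<and>
     inj_on (($) a) {..<dim_vec a} \<and>
     (\<forall>T. T \<subset> set\<^sub>v a \<longrightarrow> nat_combinations T \<noteq> nat_combinations (set\<^sub>v a))"

definition principal_of :: "int mat \<Rightarrow> nat vec \<Rightarrow> bool" where
  "principal_of A a \<longleftrightarrow>
     minimally_generates a \<and>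
     A \<in> carrier_mat (dim_vec a) (dim_vec a) \<and>
     (\<forall>i < dim_vec a. \<forall>j < dim_vec a. i \<noteq> j \<longrightarrow> 0 \<le> A $$ (i, j)) \<and>
     A *\<^sub>v map_vec int a = 0\<^sub>v (dim_vec a) \<and>
     (\<forall>i < dim_vec a. \<exists>c > 0.
        A $$ (i, i) = - int c \<and>
        c * a $ i \<in> nat_combinations (set\<^sub>v a - {a $ i}) \<and>
        (\<forall>c' > 0. c' * a $ i \<in> nat_combinations (set\<^sub>v a - {a $ i}) \<longrightarrow> c \<le> c'))"

(* Rank over the field of fractions. *)
definition int_mat_rank :: "int mat \<Rightarrow> nat" where
  "int_mat_rank A = vec_space.rank (dim_row A) (map_mat rat_of_int A)"

definition principal_minor :: "int mat \<Rightarrow> nat set \<Rightarrow> int" where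
  "principal_minor A I = det (submatrix A I I)"

definition reorder_mat :: "(nat \<Rightarrow> nat) \<Rightarrow> int mat \<Rightarrow> int mat" where
  "reorder_mat p A = mat (dim_row A) (dim_col A) (\<lambda>(i, j). A $$ (p i, p j))"

definition reorder_vec :: "(nat \<Rightarrow> nat) \<Rightarrow> nat vec \<Rightarrow> nat vec" where
  "reorder_vec p a = vec (dim_vec a) (\<lambda>i. a $ p i)"

end

theory Submission
  imports Defs "Jordan_Normal_Form.Matrix_Kernel"
begin

text \<open>
  A vanishing principal minor of size \<open>n - 1\<close>, with index \<open>k\<close> omitted, gives a nonzero row
  vector \<open>w\<close> with \<open>w\<^sub>k = 0\<close> such that \<open>w A\<close> vanishes outside \<open>k\<close>; since \<open>w A \<bullet> a = 0\<close> and
  \<open>a\<^sub>k > 0\<close>, even \<open>w A = 0\<close>. By the sign pattern of \<open>A\<close> the entrywise absolute value of \<open>w\<close> is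
  again in the left kernel, and comparing signs shows that \<open>A\<close> has zeros at all positions \<open>(i, j)\<close>
  with \<open>i\<close> in the support of \<open>w\<close> and \<open>j\<close> outside. This support is the index set of \<open>D\<close>.
  For the rank of \<open>D\<close>, a square matrix has corank one iff its kernel is a line, and kernel vectors
  of \<open>D\<close> extend to kernel vectors of \<open>A\<close>.
\<close>

section \<open>Corank one as a statement about kernel lines\<close>

lemma rank_plus_kernel_dim:
  fixes M :: "'a :: field mat"
  assumes M: "M \<in> carrier_mat m m"
  shows "vec_space.rank m M + kernel.dim m M = m"
proof -
  interpret V: vec_space "TYPE('a)" m .
  interpret T: linear_map class_ring V.V V.V "\<lambda>v. M *\<^sub>v v"
    apply unfold_locales
    unfolding LinearCombinations.module_hom_def
    using M
    by (auto simp: mult_add_distrib_mat_vec[OF M] mult_mat_vec[OF M] module_vec_simps class_ring_simps)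
  have "T.imT = V.col_space M"
    using M V.col_space_eq[OF M] unfolding T.im_def by (auto simp: module_vec_simps)
  moreover have "T.kerT = mat_kernel M"
    using M unfolding T.ker_def mat_kernel_def by (auto simp: module_vec_simps)
  ultimately show ?thesis
    using T.rank_nullity[OF V.fin_dim] V.dim_is_n
    by (simp add: V.rank_def V.col_space_def)
qed

lemma smult_vec_eq_0_iff:
  fixes v :: "'a :: idom vec"
  shows "c \<cdot>\<^sub>v v = 0\<^sub>v (dim_vec v) \<longleftrightarrow> c = 0 \<or> v = 0\<^sub>v (dim_vec v)"
  by (auto simp: vec_eq_iff)

text \<open>By rank-nullity the rank is \<open>m - 1\<close> exactly when the kernel has dimension
  one. A nonzero \<open>u\<close> is independent, so this means that \<open>{u}\<close> is a basis.
  In this form the rank condition passes easily through permutations and blocks.\<close>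

lemma rank_eq_pred_iff_kernel_line:
  fixes M :: "'a :: field mat"
  assumes M: "M \<in> carrier_mat m m" and u: "u \<in> mat_kernel M" "u \<noteq> 0\<^sub>v m"
  shows "vec_space.rank m M = m - 1 \<longleftrightarrow> (\<forall>x \<in> mat_kernel M. \<exists>c. x = c \<cdot>\<^sub>v u)"
proof -
  interpret K: kernel m m M by (unfold_locales, rule M)
  have uc: "u \<in> carrier_vec m" using mat_kernelD[OF M u(1)] by simp
  have lc: "K.lincomb a {u} = a u \<cdot>\<^sub>v u" for a
    using u uc by (simp add: K.lincomb_same K.NC.lincomb_def module_vec_simps)
  have span: "K.span {u} = {c \<cdot>\<^sub>v u | c. True}"
    using u by (subst K.Ker.finite_span) (auto simp: lc)
  have li: "\<not> K.lin_dep {u}"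
  proof (rule K.Ker.finite_lin_indpt2)
    fix a assume "K.lincomb a {u} = 0\<^sub>v m"
    then show "\<forall>v\<in>{u}. a v = 0" using u uc smult_vec_eq_0_iff[of "a u" u] by (auto simp: lc)
  qed (use u in auto)
  \<comment> \<open>A basis is fetched only to know that the kernel is finite-dimensional.\<close>
  obtain B where B: "finite B" "K.basis B" using kernel_basis_exists[OF M] by blast
  then have fd: "K.Ker.fin_dim" unfolding K.Ker.fin_dim_def K.Ker.basis_def by auto
  have "K.dim = 1 \<longleftrightarrow> K.basis {u}"
    using K.Ker.dim_basis[of "{u}"] K.Ker.dim_li_is_basis[OF fd, of "{u}"] u li by auto
  also have "\<dots> \<longleftrightarrow> K.span {u} = mat_kernel M"
    using u li by (auto simp: K.Ker.basis_def)
  also have "\<dots> \<longleftrightarrow> (\<forall>x \<in> mat_kernel M. \<exists>c. x = c \<cdot>\<^sub>v u)"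
    using mat_kernel_smult[OF M u(1)] by (auto simp: span)
  finally have "K.dim = 1 \<longleftrightarrow> (\<forall>x \<in> mat_kernel M. \<exists>c. x = c \<cdot>\<^sub>v u)" .
  moreover have "1 \<le> K.dim" using K.Ker.li_le_dim(2)[OF fd _ li] u by simp
  ultimately show ?thesis
    using rank_plus_kernel_dim[OF M] by auto
qed

lemma smult_one_mat_mult_vec:
  fixes z :: "'a :: comm_ring_1 vec"
  assumes "z \<in> carrier_vec s"
  shows "(d \<cdot>\<^sub>m 1\<^sub>m s) *\<^sub>v z = d \<cdot>\<^sub>v z"
proof (rule eq_vecI)
  fix i assume "i < dim_vec (d \<cdot>\<^sub>v z)"
  then have i: "i < s" using assms by simp
  have "((d \<cdot>\<^sub>m 1\<^sub>m s) *\<^sub>v z) $ i = (\<Sum>j\<in>{0..<s}. d * (if j = i then 1 else 0) * z $ j)"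
    using i assms by (simp add: scalar_prod_def)
  also have "\<dots> = (\<Sum>j\<in>{0..<s}. if j = i then d * z $ j else 0)"
    by (intro sum.cong) auto
  finally show "((d \<cdot>\<^sub>m 1\<^sub>m s) *\<^sub>v z) $ i = (d \<cdot>\<^sub>v z) $ i" using i assms by simp
qed (use assms in simp)

text \<open>Once \<open>B\<close> is known to be invertible, every kernel vector \<open>x\<close> of
  \<open>D\<close> extends to a kernel vector of the block matrix. The extension lies on the given
  line, and its first \<open>m\<close> coordinates give the claim.\<close>

lemma kernel_line_block:
  fixes D :: "'a :: field mat"
  assumes D: "D \<in> carrier_mat m m" and C: "C \<in> carrier_mat s m" and B: "B \<in> carrier_mat s s"
    and u: "u \<in> carrier_vec m" "u \<noteq> 0\<^sub>v m" and v: "v \<in> carrier_vec s"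
    and line: "\<forall>x \<in> mat_kernel (four_block_mat D (0\<^sub>m m s) C B). \<exists>c. x = c \<cdot>\<^sub>v (u @\<^sub>v v)"
    and x: "x \<in> mat_kernel D"
  shows "\<exists>c. x = c \<cdot>\<^sub>v u"
proof -
  let ?M = "four_block_mat D (0\<^sub>m m s) C B"
  have smult: "c \<cdot>\<^sub>v (u @\<^sub>v v) = c \<cdot>\<^sub>v u @\<^sub>v c \<cdot>\<^sub>v v" for c
    using u v by auto
  have line': "\<exists>c. x = c \<cdot>\<^sub>v u \<and> y = c \<cdot>\<^sub>v v"
    if x: "x \<in> carrier_vec m" "D *\<^sub>v x = 0\<^sub>v m"
      and y: "y \<in> carrier_vec s" "C *\<^sub>v x + B *\<^sub>v y = 0\<^sub>v s" for x y
  proof -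
    have "?M *\<^sub>v (x @\<^sub>v y) = (D *\<^sub>v x + 0\<^sub>m m s *\<^sub>v y) @\<^sub>v (C *\<^sub>v x + B *\<^sub>v y)"
      using D C B x y by (intro four_block_mat_mult_vec) auto
    also have "0\<^sub>m m s *\<^sub>v y = 0\<^sub>v m" using y by auto
    also have "(D *\<^sub>v x + 0\<^sub>v m) @\<^sub>v (C *\<^sub>v x + B *\<^sub>v y) = 0\<^sub>v (m + s)"
      unfolding x y by auto
    finally have "x @\<^sub>v y \<in> mat_kernel ?M"
      using D B x y by (intro mat_kernelI) auto
    then obtain c where "x @\<^sub>v y = c \<cdot>\<^sub>v u @\<^sub>v c \<cdot>\<^sub>v v" using line smult by metis
    then show ?thesis using x u by (auto simp: append_vec_eq[of _ m])
  qed
  have xc: "x \<in> carrier_vec m" "D *\<^sub>v x = 0\<^sub>v m" using mat_kernelD[OF D x] by auto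
  have Cx: "C *\<^sub>v x \<in> carrier_vec s" using C xc by auto
  \<comment> \<open>Otherwise a kernel vector of \<open>B\<close>, padded with zeros, would lie on the line through \<open>u @\<^sub>v v\<close>,
      although \<open>u\<close> is nonzero.\<close>
  have "det B \<noteq> 0"
  proof
    assume "det B = 0"
    then obtain y where y: "y \<in> carrier_vec s" "y \<noteq> 0\<^sub>v s" "B *\<^sub>v y = 0\<^sub>v s"
      using det_0_iff_vec_prod_zero[OF B] by blast
    have "D *\<^sub>v 0\<^sub>v m = 0\<^sub>v m" "C *\<^sub>v 0\<^sub>v m = 0\<^sub>v s" using D C by auto
    then obtain c where c: "0\<^sub>v m = c \<cdot>\<^sub>v u" "y = c \<cdot>\<^sub>v v" using line'[of "0\<^sub>v m" y] y by auto
    obtain i where "i < m" "u $ i \<noteq> 0" using u by (auto simp: vec_eq_iff)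
    then have "c = 0" using c(1) u by (metis carrier_vecD index_smult_vec(1) index_zero_vec(1) mult_eq_0_iff)
    then show False using c(2) y v by auto
  qed
  \<comment> \<open>This is \<open>- B^(-1) C x\<close>, with the inverse written through the
    adjugate; it makes the lower block of the product vanish.\<close>
  define y where "y = (inverse (det B)) \<cdot>\<^sub>v (adj_mat B *\<^sub>v (- (C *\<^sub>v x)))"
  have y: "y \<in> carrier_vec s" using adj_mat(1)[OF B] Cx by (auto simp: y_def)
  have "B *\<^sub>v y = inverse (det B) \<cdot>\<^sub>v (B *\<^sub>v (adj_mat B *\<^sub>v (- (C *\<^sub>v x))))"
    unfolding y_def using adj_mat(1)[OF B] Cx by (intro mult_mat_vec[OF B]) auto
  also have "B *\<^sub>v (adj_mat B *\<^sub>v (- (C *\<^sub>v x))) = (B * adj_mat B) *\<^sub>v (- (C *\<^sub>v x))"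
    using adj_mat(1)[OF B] Cx B by (intro assoc_mult_mat_vec[symmetric]) auto
  also have "inverse (det B) \<cdot>\<^sub>v \<dots> = - (C *\<^sub>v x)"
    unfolding adj_mat(2)[OF B] smult_one_mat_mult_vec[OF uminus_carrier_vec[THEN iffD2, OF Cx]]
    using \<open>det B \<noteq> 0\<close> by (simp add: smult_smult_assoc)
  finally have "C *\<^sub>v x + B *\<^sub>v y = 0\<^sub>v s" using Cx by auto
  then show ?thesis using line'[OF xc y] by blast
qed

section \<open>Left kernel vectors and signs\<close>

lemma mult_mat_vec_eq_0_iff:
  assumes "A \<in> carrier_mat nr nc" "v \<in> carrier_vec nc"
  shows "A *\<^sub>v v = 0\<^sub>v nr \<longleftrightarrow> (\<forall>i<nr. (\<Sum>j<nc. A $$ (i, j) * v $ j) = 0)"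
  using assms by (auto simp: vec_eq_iff scalar_prod_def lessThan_atLeast0)

text \<open>The transposed submatrix is singular, and its kernel vector is a left kernel vector of
  the submatrix. It is indexed by elements of \<open>I\<close> rather than by positions, so that it
  can later be extended by zero to all indices.\<close>

lemma principal_minor_0_left_kernel:
  assumes A: "A \<in> carrier_mat n n" and I: "I \<subseteq> {..<n}" and det: "principal_minor A I = 0"
  obtains w where "\<exists>i\<in>I. w i \<noteq> 0" and "\<forall>j\<in>I. (\<Sum>i\<in>I. w i * A $$ (i, j)) = 0"
proof -
  define k where "k = card I"
  have I': "{i. i < n \<and> i \<in> I} = I" using I by auto
  have fin: "finite I" using I finite_subset by blast
  define M where "M = submatrix A I I"
  have M: "M \<in> carrier_mat k k" 
    using carrier_matD[OF A] I' by (intro carrier_matI) (simp_all only: M_def k_def dim_submatrix)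
  have bij: "bij_betw (pick I) {..<k} I"
    unfolding bij_betw_def
  proof
    show inj: "inj_on (pick I) {..<k}"
      unfolding k_def by (rule linorder_inj_onI) (auto dest: pick_mono_le[rotated])
    have "pick I ` {..<k} \<subseteq> I" using pick_in_set_le k_def by auto
    moreover have "card (pick I ` {..<k}) = card I" using card_image[OF inj] k_def by simp
    ultimately show "pick I ` {..<k} = I" using fin by (metis card_subset_eq)
  qed
  have "det M\<^sup>T = 0" using det det_transpose[OF M] by (simp add: principal_minor_def M_def)
  then obtain v where v: "v \<in> carrier_vec k" "v \<noteq> 0\<^sub>v k" "M\<^sup>T *\<^sub>v v = 0\<^sub>v k"
    using det_0_iff_vec_prod_zero[of "M\<^sup>T" k] M by auto
  \<comment> \<open>The increasing enumeration \<open>pick I\<close> is inverted to move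
    \<open>v\<close> from positions to elements of \<open>I\<close>.\<close>
  define w where "w i = v $ inv_into {..<k} (pick I) i" for i
  have w: "w (pick I i) = v $ i" if "i < k" for i
    using that bij by (simp add: w_def bij_betw_inv_into_left)
  obtain i where "i < k" "v $ i \<noteq> 0" using v by (auto simp: vec_eq_iff)
  then have "\<exists>i\<in>I. w i \<noteq> 0" using w bij by (metis bij_betwE lessThan_iff)
  moreover have "(\<Sum>i\<in>I. w i * A $$ (i, j)) = 0" if jI: "j \<in> I" for j
  proof -
    obtain j' where j': "j' < k" "j = pick I j'"
      using jI bij_betw_imp_surj_on[OF bij] by fast
    have "(\<Sum>i\<in>I. w i * A $$ (i, j)) = (\<Sum>i<k. w (pick I i) * A $$ (pick I i, j))"
      by (rule sum.reindex_bij_betw[OF bij, symmetric])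
    also have "\<dots> = (\<Sum>i<k. M\<^sup>T $$ (j', i) * v $ i)"
    proof (rule sum.cong[OF refl])
      fix i assume i: "i \<in> {..<k}"
      have "M $$ (i, j') = A $$ (pick I i, pick I j')"
        unfolding M_def using i j' carrier_matD[OF A] I'
        by (intro submatrix_index) (simp_all only: k_def lessThan_iff)
      then show "w (pick I i) * A $$ (pick I i, j) = M\<^sup>T $$ (j', i) * v $ i"
        using w[of i] i j' carrier_matD[OF M] by simp
    qed
    also have "\<dots> = 0"
      using v(3) j'(1) unfolding mult_mat_vec_eq_0_iff[OF iffD2[OF transpose_carrier_mat M] v(1)] by blast
    finally show ?thesis .
  qed
  ultimately show thesis using that by blast
qed

text \<open>
  Each component of \<open>|w| f\<close> is nonnegative by the triangle inequality, while the \<open>a\<close>-weighted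
  sum of all components is zero.
\<close>
lemma abs_left_kernel:
  fixes f :: "nat \<Rightarrow> nat \<Rightarrow> 'a :: linordered_idom"
  assumes off: "\<And>i j. i < n \<Longrightarrow> j < n \<Longrightarrow> i \<noteq> j \<Longrightarrow> 0 \<le> f i j"
    and a: "\<And>i. i < n \<Longrightarrow> 0 < a i"
    and ker: "\<And>i. i < n \<Longrightarrow> (\<Sum>j<n. f i j * a j) = 0"
    and w: "\<And>j. j < n \<Longrightarrow> (\<Sum>i<n. w i * f i j) = 0"
    and j: "j < n"
  shows "(\<Sum>i<n. \<bar>w i\<bar> * f i j) = 0"
proof -
  have nonneg: "0 \<le> (\<Sum>i<n. \<bar>w i\<bar> * f i j)" if j: "j < n" for j
  proof -
    have split: "(\<Sum>i<n. g i) = g j + (\<Sum>i\<in>{..<n} - {j}. g i)" for g :: "nat \<Rightarrow> 'a"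
      using j by (intro sum.remove) auto
    \<comment> \<open>The column equation makes the diagonal term cancel the off-diagonal sum, so
      both have the same absolute value, to which the triangle inequality applies.\<close>
    have "- (\<bar>w j\<bar> * f j j) \<le> \<bar>w j * f j j\<bar>"
      unfolding abs_mult mult_minus_right[symmetric] by (intro mult_left_mono) auto
    also have "\<dots> = \<bar>\<Sum>i\<in>{..<n} - {j}. w i * f i j\<bar>"
      using w[OF j] unfolding split[of "\<lambda>i. w i * f i j"] by (metis abs_minus_cancel eq_neg_iff_add_eq_0)
    also have "\<dots> \<le> (\<Sum>i\<in>{..<n} - {j}. \<bar>w i * f i j\<bar>)" by (rule sum_abs)
    also have "\<dots> = (\<Sum>i\<in>{..<n} - {j}. \<bar>w i\<bar> * f i j)"
      using off j by (intro sum.cong) (auto simp: abs_mult)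
    finally show ?thesis unfolding split[of "\<lambda>i. \<bar>w i\<bar> * f i j"] by (simp add: algebra_simps)
  qed
  have "(\<Sum>j<n. (\<Sum>i<n. \<bar>w i\<bar> * f i j) * a j) = (\<Sum>i<n. \<bar>w i\<bar> * (\<Sum>j<n. f i j * a j))"
    unfolding sum_distrib_left sum_distrib_right
    by (subst sum.swap) (simp add: mult.assoc)
  also have "\<dots> = 0" using ker by simp
  finally have "(\<Sum>i<n. \<bar>w i\<bar> * f i j) * a j = 0"
    using nonneg a j by (subst (asm) sum_nonneg_eq_0_iff) (auto simp: less_imp_le)
  then show ?thesis using a[OF j] by simp
qed

section \<open>Rank and reordering of pseudo principal matrices\<close>

lemma pseudo_principal_of_iff:
  assumes "dim_vec a = n"
  shows "pseudo_principal_of A a \<longleftrightarrow>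
    A \<in> carrier_mat n n \<and> (\<forall>i<n. A $$ (i, i) < 0) \<and>
    (\<forall>i<n. \<forall>j<n. i \<noteq> j \<longrightarrow> 0 \<le> A $$ (i, j)) \<and> (\<forall>i<n. 0 < a $ i) \<and>
    (\<forall>i<n. (\<Sum>j<n. A $$ (i, j) * int (a $ j)) = 0)"
proof -
  have "A *\<^sub>v map_vec int a = 0\<^sub>v n \<longleftrightarrow> (\<forall>i<n. (\<Sum>j<n. A $$ (i, j) * int (a $ j)) = 0)"
    if "A \<in> carrier_mat n n"
    using mult_mat_vec_eq_0_iff[OF that, of "map_vec int a"] assms by auto
  then show ?thesis unfolding pseudo_principal_of_def assms by blast
qed

text \<open>The vector \<open>a\<close> itself, read over the rationals, is the nonzero kernel
  vector needed by the kernel line criterion; positivity of its entry 0 shows that it is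
  nonzero.\<close>

lemma int_mat_rank_eq_pred_iff:
  assumes pp: "pseudo_principal_of A a" and n: "dim_vec a = n" "0 < n"
  shows "int_mat_rank A = n - 1 \<longleftrightarrow>
    (\<forall>x \<in> mat_kernel (map_mat rat_of_int A). \<exists>c. x = c \<cdot>\<^sub>v map_vec of_nat a)"
proof -
  note pp' = pp[unfolded pseudo_principal_of_iff[OF n(1)]]
  define M where "M = map_mat rat_of_int A"
  define u :: "rat vec" where "u = map_vec of_nat a"
  have M: "M \<in> carrier_mat n n" using pp' by (simp add: M_def)
  have u: "u \<in> carrier_vec n" using n by (intro carrier_vecI) (simp add: u_def)
  have "(\<Sum>j<n. M $$ (i, j) * u $ j) = 0" if i: "i < n" for i
  proof -
    have "(\<Sum>j<n. M $$ (i, j) * u $ j) = of_int (\<Sum>j<n. A $$ (i, j) * int (a $ j))"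
      unfolding of_int_sum of_int_mult using pp' n i
      by (intro sum.cong) (auto simp: M_def u_def)
    then show ?thesis using pp' i by simp
  qed
  then have ker: "u \<in> mat_kernel M"
    using mult_mat_vec_eq_0_iff[OF M u] by (intro mat_kernelI[OF M u]) blast
  have "u $ 0 \<noteq> 0" using pp' n by (simp add: u_def)
  then have "u \<noteq> 0\<^sub>v n" using n by auto
  from rank_eq_pred_iff_kernel_line[OF M ker this] show ?thesis
    using M unfolding int_mat_rank_def M_def u_def by simp
qed

lemma pseudo_principal_of_reorder:
  assumes pp: "pseudo_principal_of A a" and n: "dim_vec a = n" and p: "p permutes {..<n}"
  shows "pseudo_principal_of (reorder_mat p A) (reorder_vec p a)"
proof -
  note pp' = pp[unfolded pseudo_principal_of_iff[OF n]]
  have A: "dim_row A = n" "dim_col A = n" using pp' by auto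
  have pn: "p i < n" if "i < n" for i using permutes_in_image[OF p] that by (metis lessThan_iff)
  have inj: "p i = p j \<longleftrightarrow> i = j" for i j using permutes_inj[OF p] by (auto dest: injD)
  have "(\<Sum>j<n. A $$ (p i, p j) * int (a $ p j)) = 0" if "i < n" for i
    using pp' pn[OF that] sum.permute[OF p, of "\<lambda>j. A $$ (p i, j) * int (a $ j)"]
    by (simp add: comp_def)
  then show ?thesis
    using pp' pn inj n
    by (subst pseudo_principal_of_iff[of _ n]) (auto simp: reorder_mat_def reorder_vec_def A)
qed

text \<open>Permuting coordinates back turns a kernel vector of the reordered matrix into one of
  \<open>A\<close>, where the line is known.\<close>

lemma kernel_line_reorder:
  assumes A: "A \<in> carrier_mat n n" and n: "dim_vec a = n" and p: "p permutes {..<n}"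
    and line: "\<forall>x \<in> mat_kernel (map_mat rat_of_int A). \<exists>c. x = c \<cdot>\<^sub>v map_vec of_nat a"
    and x: "x \<in> mat_kernel (map_mat rat_of_int (reorder_mat p A))"
  shows "\<exists>c. x = c \<cdot>\<^sub>v map_vec of_nat (reorder_vec p a)"
proof -
  let ?q = "Hilbert_Choice.inv p"
  have q: "?q permutes {..<n}" by (rule permutes_inv[OF p])
  have pn: "p i < n" if "i < n" for i using permutes_in_image[OF p] that by (metis lessThan_iff)
  have qn: "?q i < n" if "i < n" for i using permutes_in_image[OF q] that by (metis lessThan_iff)
  define M where "M = map_mat rat_of_int (reorder_mat p A)"
  have M: "M \<in> carrier_mat n n" using A by (auto simp: M_def reorder_mat_def)
  have xc: "x \<in> carrier_vec n" and Mx: "M *\<^sub>v x = 0\<^sub>v n"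
    using mat_kernelD[OF M] x by (auto simp: M_def)
  \<comment> \<open>Composition with the inverse of \<open>p\<close> gives
    \<open>y $ p j = x $ j\<close>, so row \<open>i\<close> of \<open>A\<close> applied to
    \<open>y\<close> is row \<open>?q i\<close> of \<open>M\<close> applied to
    \<open>x\<close>.\<close>
  define y where "y = vec n (\<lambda>i. x $ ?q i)"
  have yc: "y \<in> carrier_vec n" by (simp add: y_def)
  have A': "map_mat rat_of_int A \<in> carrier_mat n n" using A by simp
  have "(\<Sum>j<n. map_mat rat_of_int A $$ (i, j) * y $ j) = 0" if i: "i < n" for i
  proof -
    have "(\<Sum>j<n. map_mat rat_of_int A $$ (i, j) * y $ j)
        = (\<Sum>j<n. map_mat rat_of_int A $$ (i, p j) * y $ p j)"
      using sum.permute[OF p, of "\<lambda>j. map_mat rat_of_int A $$ (i, j) * y $ j"] by (simp add: comp_def)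
    also have "\<dots> = (\<Sum>j<n. M $$ (?q i, j) * x $ j)"
      using A i pn qn permutes_inverses[OF p]
      by (auto simp: M_def reorder_mat_def y_def intro!: sum.cong)
    also have "\<dots> = 0" using Mx qn[OF i] unfolding mult_mat_vec_eq_0_iff[OF M xc] by blast
    finally show ?thesis .
  qed
  then have "y \<in> mat_kernel (map_mat rat_of_int A)"
    using mult_mat_vec_eq_0_iff[OF A' yc] by (intro mat_kernelI[OF A' yc]) blast
  then obtain c where c: "y = c \<cdot>\<^sub>v map_vec of_nat a" using line by blast
  have "x $ i = c * of_nat (a $ p i)" if "i < n" for i
  proof -
    have "x $ i = y $ p i" using that pn permutes_inverses[OF p] by (simp add: y_def)
    then show ?thesis using c pn[OF that] n by simp
  qed
  then have "x = c \<cdot>\<^sub>v map_vec of_nat (reorder_vec p a)"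
    using xc n by (intro eq_vecI) (auto simp: reorder_vec_def)
  then show ?thesis by blast
qed

section \<open>Monoids of non-negative combinations\<close>

lemma nat_combinationsI: "(\<Sum>x\<in>X. k x * x) \<in> nat_combinations X"
  unfolding nat_combinations_def by blast

lemma nat_combinations_mono:
  assumes "finite Y" "X \<subseteq> Y"
  shows "nat_combinations X \<subseteq> nat_combinations Y"
proof
  fix z assume "z \<in> nat_combinations X"
  then obtain k where k: "z = (\<Sum>x\<in>X. k x * x)" by (auto simp: nat_combinations_def)
  have "z = (\<Sum>x\<in>Y. (if x \<in> X then k x else 0) * x)"
    unfolding k using assms by (intro sum.mono_neutral_cong_left) auto
  then show "z \<in> nat_combinations Y" by (simp only: nat_combinationsI)
qed

lemma nat_combinations_add:
  assumes "y \<in> nat_combinations X" "z \<in> nat_combinations X"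
  shows "y + z \<in> nat_combinations X"
proof -
  obtain k l where "y = (\<Sum>x\<in>X. k x * x)" "z = (\<Sum>x\<in>X. l x * x)"
    using assms by (auto simp: nat_combinations_def)
  then have "y + z = (\<Sum>x\<in>X. (k x + l x) * x)"
    by (simp add: sum.distrib add_mult_distrib)
  then show ?thesis by (simp only: nat_combinationsI)
qed

text \<open>Serves to lift a redundancy among some of the generators to the whole generating set, by
  adjoining the remaining ones as \<open>R\<close>.\<close>

lemma nat_combinations_Un_subset:
  assumes fin: "finite X" "finite Y" "finite R" and sub: "nat_combinations X \<subseteq> nat_combinations Y"
  shows "nat_combinations (X \<union> R) \<subseteq> nat_combinations (Y \<union> R)"
proof
  fix z assume "z \<in> nat_combinations (X \<union> R)"
  then obtain k where k: "z = (\<Sum>x\<in>X \<union> R. k x * x)" by (auto simp: nat_combinations_def)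
  \<comment> \<open>Removing \<open>X\<close> from \<open>R\<close> keeps common generators from
    being counted twice.\<close>
  have "z = (\<Sum>x\<in>X. k x * x) + (\<Sum>x\<in>R - X. k x * x)"
    unfolding k using fin by (subst sum.union_disjoint[symmetric]) (auto intro!: sum.cong)
  moreover have "(\<Sum>x\<in>X. k x * x) \<in> nat_combinations (Y \<union> R)"
  proof -
    have "(\<Sum>x\<in>X. k x * x) \<in> nat_combinations X" by (rule nat_combinationsI)
    then show ?thesis using sub nat_combinations_mono[of "Y \<union> R" Y] fin by blast
  qed
  moreover have "(\<Sum>x\<in>R - X. k x * x) \<in> nat_combinations (Y \<union> R)"
  proof -
    have "(\<Sum>x\<in>R - X. k x * x) \<in> nat_combinations (R - X)" by (rule nat_combinationsI)
    then show ?thesis using nat_combinations_mono[of "Y \<union> R" "R - X"] fin by blast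
  qed
  ultimately show "z \<in> nat_combinations (Y \<union> R)" by (simp add: nat_combinations_add)
qed

text \<open>Monoids are generated by sets of values while matrix rows give sums over indices;
  injectivity lets each coefficient be attached to a value.\<close>

lemma sum_mult_in_nat_combinations:
  assumes "inj_on f J"
  shows "(\<Sum>j\<in>J. k j * f j) \<in> nat_combinations (f ` J)"
proof -
  have "(\<Sum>x\<in>f ` J. k (inv_into J f x) * x) = (\<Sum>j\<in>J. k j * f j)"
    using assms by (subst sum.reindex) (auto intro!: sum.cong)
  then show ?thesis using nat_combinationsI[of "\<lambda>x. k (inv_into J f x)" "f ` J"] by simp
qed

section \<open>Zero patterns and leading blocks\<close>

text \<open>Brings \<open>S\<close> to the front: a bijection from the initial segment onto
  \<open>S\<close> is glued to one from the remaining indices onto the complement.\<close>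

lemma ex_permutes_image_lessThan:
  assumes "S \<subseteq> {..<n}"
  obtains p where "p permutes {..<n}" "p ` {..<card S} = S"
proof -
  have fin: "finite S" using assms finite_subset by blast
  have le: "card S \<le> n" using card_mono[OF _ assms] by simp
  obtain f where f: "bij_betw f {..<card S} S"
    using fin by (metis bij_betw_iff_card card_lessThan finite_lessThan)
  have "card {card S..<n} = card ({..<n} - S)"
    using assms fin by (simp add: card_Diff_subset)
  then obtain g where g: "bij_betw g {card S..<n} ({..<n} - S)"
    by (metis bij_betw_iff_card finite_Diff finite_atLeastLessThan finite_lessThan)
  \<comment> \<open>Outside \<open>{..<n}\<close> the map is the identity, as
    \<open>permutes\<close> demands.\<close>
  define p where "p i = (if i < card S then f i else if i < n then g i else i)" for i
  have pf: "bij_betw p {..<card S} S"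
    using f by (rule iffD1[OF bij_betw_cong, rotated]) (auto simp: p_def)
  have pg: "bij_betw p {card S..<n} ({..<n} - S)"
    using g by (rule iffD1[OF bij_betw_cong, rotated]) (auto simp: p_def)
  have "{..<card S} \<union> {card S..<n} = {..<n}" "S \<union> ({..<n} - S) = {..<n}" using le assms by auto
  then have "bij_betw p {..<n} {..<n}" using bij_betw_combine[OF pf pg] by auto
  then have "p permutes {..<n}" by (rule bij_imp_permutes) (use le in \<open>auto simp: p_def\<close>)
  moreover have "p ` {..<card S} = S" using pf by (rule bij_betw_imp_surj_on)
  ultimately show thesis using that by blast
qed

lemma zero_pattern_of_vanishing_minor:
  assumes pp: "pseudo_principal_of A a" and n: "dim_vec a = n"
    and k: "k < n" and minor: "principal_minor A ({..<n} - {k}) = 0"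
  obtains S where "S \<subset> {..<n}" "S \<noteq> {}" "\<forall>i\<in>S. \<forall>j<n. j \<notin> S \<longrightarrow> A $$ (i, j) = 0"
proof -
  note pp' = pp[unfolded pseudo_principal_of_iff[OF n]]
  have A: "A \<in> carrier_mat n n" using pp' by blast
  let ?I = "{..<n} - {k}"
  obtain v where v: "\<exists>i\<in>?I. v i \<noteq> 0" "\<forall>j\<in>?I. (\<Sum>i\<in>?I. v i * A $$ (i, j)) = 0"
    using principal_minor_0_left_kernel[OF A _ minor] by blast
  \<comment> \<open>The value zero at \<open>k\<close> turns sums over \<open>?I\<close> into sums
    over all indices.\<close>
  define w where "w i = (if i = k then 0 else v i)" for i
  have sum_w: "(\<Sum>i<n. w i * A $$ (i, j)) = (\<Sum>i\<in>?I. v i * A $$ (i, j))" for j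
    by (intro sum.mono_neutral_cong_right) (auto simp: w_def)
  have off: "(\<Sum>i<n. w i * A $$ (i, j)) = 0" if "j < n" "j \<noteq> k" for j
    unfolding sum_w using v that by simp
  \<comment> \<open>Computed row by row this sum is zero, because \<open>a\<close> is in the kernel.
    Computed column by column only column \<open>k\<close> survives; as \<open>a $ k\<close> is
    positive, that column is annihilated by \<open>w\<close> too.\<close>
  have "(\<Sum>j<n. (\<Sum>i<n. w i * A $$ (i, j)) * int (a $ j))
      = (\<Sum>i<n. w i * (\<Sum>j<n. A $$ (i, j) * int (a $ j)))"
    unfolding sum_distrib_left sum_distrib_right
    by (subst sum.swap) (simp add: mult.assoc)
  also have "\<dots> = 0" using pp' by simp
  also have "(\<Sum>j<n. (\<Sum>i<n. w i * A $$ (i, j)) * int (a $ j))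
      = (\<Sum>i<n. w i * A $$ (i, k)) * int (a $ k)"
    using k off by (subst sum.remove[of _ k]) auto
  finally have "(\<Sum>i<n. w i * A $$ (i, k)) = 0" using pp' k by auto
  then have w: "(\<Sum>i<n. w i * A $$ (i, j)) = 0" if "j < n" for j
    using off that by blast
  have abs_w: "(\<Sum>i<n. \<bar>w i\<bar> * A $$ (i, j)) = 0" if "j < n" for j
    using pp' w that by (intro abs_left_kernel[where a = "\<lambda>i. int (a $ i)"]) auto
  define S where "S = {i. i < n \<and> w i \<noteq> 0}"
  have "A $$ (i, j) = 0" if i: "i \<in> S" and j: "j < n" "j \<notin> S" for i j
  proof -
    have wj: "w j = 0" using j by (simp add: S_def)
    \<comment> \<open>The only negative entry of column \<open>j\<close> is the diagonal one, and
      its weight \<open>w j\<close> is zero. Hence the vanishing column sum has no negative terms,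
      and each term is zero.\<close>
    have "0 \<le> \<bar>w l\<bar> * A $$ (l, j)" if "l < n" for l
      using pp' wj j(1) that by (cases "l = j") auto
    then have "\<bar>w i\<bar> * A $$ (i, j) = 0"
      using abs_w[OF j(1)] i by (subst (asm) sum_nonneg_eq_0_iff) (auto simp: S_def)
    then show ?thesis using i by (simp add: S_def)
  qed
  moreover have "S \<noteq> {}" using v(1) by (auto simp: S_def w_def)
  moreover have "k \<notin> S" by (simp add: S_def w_def)
  then have "S \<subset> {..<n}" using k by (auto simp: S_def)
  ultimately show thesis using that by blast
qed

text \<open>The zeros to the right of the block let its truncated row sums agree with the full
  ones.\<close>

lemma pseudo_principal_of_leading_block:
  assumes pp: "pseudo_principal_of M b" and n: "dim_vec b = n" and m: "m \<le> n"
    and zero: "\<And>i j. i < m \<Longrightarrow> m \<le> j \<Longrightarrow> j < n \<Longrightarrow> M $$ (i, j) = 0"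
  shows "pseudo_principal_of (mat m m (($$) M)) (vec_first b m)"
proof -
  note pp' = pp[unfolded pseudo_principal_of_iff[OF n]]
  have "(\<Sum>j<m. M $$ (i, j) * int (b $ j)) = 0" if "i < m" for i
  proof -
    have "(\<Sum>j<m. M $$ (i, j) * int (b $ j)) = (\<Sum>j<n. M $$ (i, j) * int (b $ j))"
      using m zero[OF that] by (intro sum.mono_neutral_left) auto
    then show ?thesis using pp' that m by simp
  qed
  then show ?thesis
    using pp' m by (subst pseudo_principal_of_iff[of _ m]) (auto simp: vec_first_def)
qed

section \<open>Minimal generation and principal matrices on part of the entries\<close>

text \<open>If some entries of the subvector were redundant for its monoid, adjoining the other
  entries of \<open>a\<close> would make them redundant for the monoid of \<open>a\<close>.\<close>

lemma minimally_generates_subvec: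
  assumes a: "minimally_generates a" and f: "inj_on f {..<m}" "f ` {..<m} \<subseteq> {..<dim_vec a}"
  shows "minimally_generates (vec m (\<lambda>i. a $ f i))"
proof -
  let ?b = "vec m (\<lambda>i. a $ f i)"
  note a' = a[unfolded minimally_generates_def]
  have fn: "f i < dim_vec a" if "i < m" for i using f that by auto
  have sub: "set\<^sub>v ?b \<subseteq> set\<^sub>v a" using fn by (auto simp: vec_set_def)
  have fin: "finite (set\<^sub>v a)" by (simp add: vec_set_def)
  have "nat_combinations T \<noteq> nat_combinations (set\<^sub>v ?b)" if T: "T \<subset> set\<^sub>v ?b" for T
  proof
    assume eq: "nat_combinations T = nat_combinations (set\<^sub>v ?b)"
    let ?R = "set\<^sub>v a - set\<^sub>v ?b"
    have fins: "finite T" "finite (set\<^sub>v ?b)" "finite ?R"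
      using T sub fin by (meson finite_subset psubset_imp_subset finite_Diff)+
    have "nat_combinations (T \<union> ?R) = nat_combinations (set\<^sub>v ?b \<union> ?R)"
      using nat_combinations_Un_subset fins eq by (metis order_refl subset_antisym)
    moreover have "set\<^sub>v ?b \<union> ?R = set\<^sub>v a" using sub by blast
    moreover have "T \<union> ?R \<subset> set\<^sub>v a" using T sub by blast
    ultimately show False using a' by metis
  qed
  moreover have "inj_on (($) ?b) {..<m}"
    using a' f fn by (auto simp: inj_on_def)
  ultimately show ?thesis using a' fn unfolding minimally_generates_def by auto
qed

text \<open>The minimal multiplier \<open>c\<close> for \<open>A\<close> works for \<open>D\<close>
  as well. The row equation of \<open>D\<close> puts the multiple into the smaller monoid, and
  minimality is inherited because fewer generators admit fewer multiples.\<close>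

lemma principal_of_subvec:
  assumes A: "principal_of A a" and f: "inj_on f {..<m}" "f ` {..<m} \<subseteq> {..<dim_vec a}"
    and pp: "pseudo_principal_of D (vec m (\<lambda>i. a $ f i))"
    and D: "\<And>i j. i < m \<Longrightarrow> j < m \<Longrightarrow> D $$ (i, j) = A $$ (f i, f j)"
  shows "principal_of D (vec m (\<lambda>i. a $ f i))"
proof -
  let ?b = "vec m (\<lambda>i. a $ f i)"
  have dim: "dim_vec ?b = m" by simp
  note pp' = pp[unfolded pseudo_principal_of_iff[OF dim]]
  have fn: "f i < dim_vec a" if "i < m" for i using f that by auto
  have min: "minimally_generates a" and min_b: "minimally_generates ?b"
    using A minimally_generates_subvec[OF _ f] by (auto simp: principal_of_def)
  have inj: "inj_on (($) ?b) {..<m}" using min_b by (simp add: minimally_generates_def)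
  have "\<exists>c>0. D $$ (i, i) = - int c \<and>
      c * ?b $ i \<in> nat_combinations (set\<^sub>v ?b - {?b $ i}) \<and>
      (\<forall>c'>0. c' * ?b $ i \<in> nat_combinations (set\<^sub>v ?b - {?b $ i}) \<longrightarrow> c \<le> c')"
    if i: "i < m" for i
  proof -
    obtain c where c: "c > 0" "A $$ (f i, f i) = - int c"
      "\<forall>c'>0. c' * a $ f i \<in> nat_combinations (set\<^sub>v a - {a $ f i}) \<longrightarrow> c \<le> c'"
      using A fn[OF i] unfolding principal_of_def by blast
    \<comment> \<open>Since the entries are distinct, dropping the value \<open>?b $ i\<close> is
      the same as dropping the index \<open>i\<close>.\<close>
    have set_b: "set\<^sub>v ?b - {?b $ i} = (($) ?b) ` ({..<m} - {i})"
      using inj i by (auto simp: vec_set_def inj_on_def)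
    have "0 = (\<Sum>j<m. D $$ (i, j) * int (?b $ j))" using pp' i by simp
    also have "\<dots> = D $$ (i, i) * int (?b $ i) + (\<Sum>j\<in>{..<m} - {i}. D $$ (i, j) * int (?b $ j))"
      using i by (intro sum.remove) auto
    \<comment> \<open>Off-diagonal entries are nonnegative, so \<open>nat\<close> loses nothing and
      they become coefficients of a combination.\<close>
    also have "(\<Sum>j\<in>{..<m} - {i}. D $$ (i, j) * int (?b $ j))
        = int (\<Sum>j\<in>{..<m} - {i}. nat (D $$ (i, j)) * ?b $ j)"
      using pp' i by (auto intro!: sum.cong)
    finally have "int (c * ?b $ i) = int (\<Sum>j\<in>{..<m} - {i}. nat (D $$ (i, j)) * ?b $ j)"
      using D[OF i i] c(2) by simp
    then have "c * ?b $ i = (\<Sum>j\<in>{..<m} - {i}. nat (D $$ (i, j)) * ?b $ j)"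
      by (simp only: of_nat_eq_iff)
    also have "\<dots> \<in> nat_combinations (set\<^sub>v ?b - {?b $ i})"
      unfolding set_b using inj by (intro sum_mult_in_nat_combinations) (auto intro: inj_on_subset)
    finally have mem: "c * ?b $ i \<in> nat_combinations (set\<^sub>v ?b - {?b $ i})" .
    have "set\<^sub>v ?b - {?b $ i} \<subseteq> set\<^sub>v a - {a $ f i}"
      using i fn by (auto simp: vec_set_def)
    then have "nat_combinations (set\<^sub>v ?b - {?b $ i}) \<subseteq> nat_combinations (set\<^sub>v a - {a $ f i})"
      by (intro nat_combinations_mono) (auto simp: vec_set_def)
    then show ?thesis using c mem D[OF i i] i by (intro exI[of _ c]) auto
  qed
  then show ?thesis
    using min_b pp by (simp add: principal_of_def pseudo_principal_of_def)
qed

section \<open>The block decomposition and the properties of its corner \<open>D\<close>\<close>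

lemma block_form_of_zero_pattern:
  assumes pp: "pseudo_principal_of A a" and n: "dim_vec a = n"
    and S: "S \<subset> {..<n}" "S \<noteq> {}" "\<forall>i\<in>S. \<forall>j<n. j \<notin> S \<longrightarrow> A $$ (i, j) = 0"
  obtains p s D C B where "p permutes {..<n}" "1 \<le> s" "s < n"
    "D \<in> carrier_mat (n - s) (n - s)" "C \<in> carrier_mat s (n - s)" "B \<in> carrier_mat s s"
    "reorder_mat p A = four_block_mat D (0\<^sub>m (n - s) s) C B"
    "pseudo_principal_of D (vec_first (reorder_vec p a) (n - s))"
proof -
  have A: "A \<in> carrier_mat n n" using pp n by (simp add: pseudo_principal_of_def)
  define m where "m = card S"
  define s where "s = n - m"
  have "finite S" using S(1) finite_subset by blast
  then have m: "0 < m" "m < n"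
    using S psubset_card_mono[OF _ S(1)] by (auto simp: m_def card_gt_0_iff)
  have s: "1 \<le> s" "s < n" "n - s = m" using m by (auto simp: s_def)
  \<comment> \<open>With \<open>S\<close> in the first \<open>m\<close> places, the zero pattern
    fills the upper right corner.\<close>
  obtain p where p: "p permutes {..<n}" and pS: "p ` {..<m} = S"
    using ex_permutes_image_lessThan[of S n] S(1) by (auto simp: m_def)
  have pn: "p i < n" if "i < n" for i using permutes_in_image[OF p] that by (metis lessThan_iff)
  have inj: "inj p" by (rule permutes_inj[OF p])
  define M where "M = reorder_mat p A"
  have M: "M \<in> carrier_mat n n" using A by (simp add: M_def reorder_mat_def)
  have zero: "M $$ (i, j) = 0" if "i < m" "m \<le> j" "j < n" for i j
  proof -
    have "p j \<notin> S" "p i \<in> S"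
      using that inj_image_mem_iff[OF inj, of _ "{..<m}"] unfolding pS by simp_all
    then have "A $$ (p i, p j) = 0" using S(3) pn[OF that(3)] by blast
    then show ?thesis using that m A by (simp add: M_def reorder_mat_def)
  qed
  define D where "D = mat m m (($$) M)"
  define C where "C = mat s m (\<lambda>(i, j). M $$ (i + m, j))"
  define B where "B = mat s s (\<lambda>(i, j). M $$ (i + m, j + m))"
  have block: "M = four_block_mat D (0\<^sub>m m s) C B"
    using M m zero by (intro eq_matI) (auto simp: D_def C_def B_def s_def)
  have ppM: "pseudo_principal_of M (reorder_vec p a)"
    unfolding M_def by (rule pseudo_principal_of_reorder[OF pp n p])
  have "dim_vec (reorder_vec p a) = n" using n by (simp add: reorder_vec_def)
  from pseudo_principal_of_leading_block[OF ppM this _ zero]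
  have ppD: "pseudo_principal_of D (vec_first (reorder_vec p a) m)" using m by (simp add: D_def)
  have "D \<in> carrier_mat m m" "C \<in> carrier_mat s m" "B \<in> carrier_mat s s"
    by (simp_all add: D_def C_def B_def)
  then show thesis
    using that[OF p s(1,2)] block ppD unfolding s(3) M_def by blast
qed

text \<open>The rank hypothesis is translated into a kernel line for \<open>A\<close>, carried to
  the reordered matrix and then to \<open>D\<close>, and translated back into a rank.\<close>

lemma rank_leading_block:
  assumes pp: "pseudo_principal_of A a" and n: "dim_vec a = n" and rank: "int_mat_rank A = n - 1"
    and p: "p permutes {..<n}" and m: "0 < m" "m + s = n"
    and D: "D \<in> carrier_mat m m" and C: "C \<in> carrier_mat s m" and B: "B \<in> carrier_mat s s"
    and block: "reorder_mat p A = four_block_mat D (0\<^sub>m m s) C B"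
    and ppD: "pseudo_principal_of D (vec_first (reorder_vec p a) m)"
  shows "int_mat_rank D = m - 1"
proof -
  let ?of = "map_mat rat_of_int"
  let ?b = "reorder_vec p a"
  have A: "A \<in> carrier_mat n n" using pp n by (simp add: pseudo_principal_of_def)
  have b: "dim_vec ?b = n" using n by (simp add: reorder_vec_def)
  \<comment> \<open>\<open>u\<close> and \<open>v\<close> are the parts of the reordered
    \<open>a\<close> belonging to \<open>D\<close> and \<open>B\<close>.\<close>
  define u :: "rat vec" where "u = map_vec of_nat (vec_first ?b m)"
  define v :: "rat vec" where "v = map_vec of_nat (vec_last ?b s)"
  have u: "u \<in> carrier_vec m" and v: "v \<in> carrier_vec s" by (auto simp: u_def v_def)
  have uv: "map_vec of_nat ?b = u @\<^sub>v v"
    using b m by (intro eq_vecI) (auto simp: u_def v_def vec_first_def vec_last_def)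
  have "u $ 0 \<noteq> 0"
    using ppD m by (simp add: u_def pseudo_principal_of_def)
  then have u0: "u \<noteq> 0\<^sub>v m" using m by auto
  have of_block: "?of (reorder_mat p A) = four_block_mat (?of D) (0\<^sub>m m s) (?of C) (?of B)"
    unfolding block using D C B by (intro eq_matI) auto
  have "\<forall>x \<in> mat_kernel (?of A). \<exists>c. x = c \<cdot>\<^sub>v map_vec of_nat a"
    using int_mat_rank_eq_pred_iff[OF pp n] rank m by simp
  then have "\<forall>x \<in> mat_kernel (?of (reorder_mat p A)). \<exists>c. x = c \<cdot>\<^sub>v (u @\<^sub>v v)"
    using kernel_line_reorder[OF A n p] unfolding uv[symmetric] by blast
  then have "\<forall>x \<in> mat_kernel (?of D). \<exists>c. x = c \<cdot>\<^sub>v u"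
    using kernel_line_block[of "?of D" m "?of C" s "?of B" u v] D C B u u0 v
    unfolding of_block by simp
  then show ?thesis
    using int_mat_rank_eq_pred_iff[OF ppD, of m] m unfolding u_def by simp
qed

lemma principal_of_leading_block:
  assumes A: "principal_of A a" and n: "dim_vec a = n" and p: "p permutes {..<n}"
    and m: "m + s = n" and D: "D \<in> carrier_mat m m" and B: "B \<in> carrier_mat s s"
    and block: "reorder_mat p A = four_block_mat D (0\<^sub>m m s) C B"
    and ppD: "pseudo_principal_of D (vec_first (reorder_vec p a) m)"
  shows "principal_of D (vec_first (reorder_vec p a) m)"
proof -
  have first: "vec_first (reorder_vec p a) m = vec m (\<lambda>i. a $ p i)"
    using n m by (auto simp: vec_first_def reorder_vec_def)
  show ?thesis
    unfolding first
  proof (rule principal_of_subvec[OF A])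
    show "inj_on p {..<m}" using permutes_inj[OF p] by (rule inj_on_subset) simp
    have "p ` {..<m} \<subseteq> p ` {..<n}" using m by (intro image_mono) auto
    then show "p ` {..<m} \<subseteq> {..<dim_vec a}" using permutes_image[OF p] n by simp
    show "pseudo_principal_of D (vec m (\<lambda>i. a $ p i))" using ppD by (simp only: first)
    show "D $$ (i, j) = A $$ (p i, p j)" if "i < m" "j < m" for i j
    proof -
      have "A \<in> carrier_mat n n" using A n by (simp add: principal_of_def)
      then have "A $$ (p i, p j) = reorder_mat p A $$ (i, j)"
        using that m by (simp add: reorder_mat_def)
      then show ?thesis using that m D B by (simp add: block)
    qed
  qed
qed

theorem theorem15:
  fixes A :: "int mat" and a :: "nat vec" and n :: nat
  assumes "1 \<le> n"
    and "dim_vec a = n"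
    and "pseudo_principal_of A a"
    and "int_mat_rank A = n - 1"
    and "\<exists>I \<subseteq> {..<n}. card I = n - 1 \<and> principal_minor A I = 0"
  shows "\<exists>p s D C B.
    p permutes {..<n} \<and> 1 \<le> s \<and> s < n \<and>
    D \<in> carrier_mat (n - s) (n - s) \<and>
    C \<in> carrier_mat s (n - s) \<and>
    B \<in> carrier_mat s s \<and>
    reorder_mat p A = four_block_mat D (0\<^sub>m (n - s) s) C B \<and>
    pseudo_principal D \<and>
    int_mat_rank D = n - s - 1 \<and>
    (principal_of A a \<longrightarrow> principal_of D (vec_first (reorder_vec p a) (n - s)))"
proof -
  note n = assms(2) and pp = assms(3)
  obtain I where I: "I \<subseteq> {..<n}" "card I = n - 1" "principal_minor A I = 0" using assms(5) by blast
  \<comment> \<open>An index set of size \<open>n - 1\<close> omits exactly one index, the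
    \<open>k\<close> of the zero pattern argument.\<close>
  have "card ({..<n} - I) = 1"
    using I assms(1) by (simp add: card_Diff_subset finite_subset)
  then obtain k where k: "{..<n} - I = {k}" by (rule card_1_singletonE)
  then have "k < n" "I = {..<n} - {k}" using I(1) by auto
  then obtain S where S: "S \<subset> {..<n}" "S \<noteq> {}" "\<forall>i\<in>S. \<forall>j<n. j \<notin> S \<longrightarrow> A $$ (i, j) = 0"
    using zero_pattern_of_vanishing_minor[OF pp n] I(3) by metis
  obtain p s D C B where p: "p permutes {..<n}" and s: "1 \<le> s" "s < n"
    and D: "D \<in> carrier_mat (n - s) (n - s)" and C: "C \<in> carrier_mat s (n - s)"
    and B: "B \<in> carrier_mat s s"
    and block: "reorder_mat p A = four_block_mat D (0\<^sub>m (n - s) s) C B"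
    and ppD: "pseudo_principal_of D (vec_first (reorder_vec p a) (n - s))"
    using block_form_of_zero_pattern[OF pp n S] .
  have m: "0 < n - s" "n - s + s = n" using s by auto
  show ?thesis
  proof (intro exI conjI impI)
    show "pseudo_principal D" using ppD unfolding pseudo_principal_def by blast
    show "int_mat_rank D = n - s - 1"
      by (rule rank_leading_block[OF pp n assms(4) p m D C B block ppD])
    show "principal_of D (vec_first (reorder_vec p a) (n - s))" if "principal_of A a"
      by (rule principal_of_leading_block[OF that n p m(2) D B block ppD])
  qed (fact p s D C B block)+
qed

end
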